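(* Let $D_1$ and $D_2$ be two digraphs on $n_1$ and $n_2$ vertices, and $m_1$ and $m_2$ arcs, respectively. Then $$f_{A(D_1\mathbin{\underline{\vee}} D_2)}(\lambda)=\lambda^{m_1-n_1}\,f_{A(D_1)}(\lambda^2)\,f_{A(D_2)}(\lambda)\,\left[1-\lambda\,\left(\lambda^2\,\chi_{A(D_1)}(\lambda^2)-n_1\right)\,\chi_{A(D_2)}(\lambda)\right].$$ In particular, the $A$-spectrum of $D_1\mathbin{\underline{\vee}} D_2$ is completely determined by the $A$-spectra of $D_1$ and $D_2$, and the $A$-coronals of $D_1$ and $D_2$.
   Context: Digraphs are finite, have at least one vertex, and are simple (no loops, no multiple arcs), but both arcs $uv$ and $vu$ may be present. The adjacency matrix $A(D)=[a_{ij}]$ of a digraph $D$ with vertices $v_1,\dots,v_n$ has $a_{ij}=1$ if $v_iv_j$ is an arc and $a_{ij}=0$ otherwise. For an $n\times n$ real matrix $M$, $f_M(\lambda)=\det(\lambda I_n-M)$ is its characteristic polynomial and its coronal is $\chi_M(\lambda)=\mathbf 1_n^T(\lambda I_n-M)^{-1}\mathbf 1_n\in\mathbb C(\lambda)$, where $\mathbf 1_n$ is the all-ones column vector. The $A$-spectrum of $D$ is the multiset of roots of $f_{A(D)}$, and the $A$-coronal of $D$ is $\chi_{A(D)}$. Identities are in $\mathbb C(\lambda)$. "Completely determined by" certain data means that equal data yield equal spectra. The subdivision digraph $\mathcal S(D)$ is obtained from $D$ by replacing each arc $uv$ by a directed path $u\to w\to v$ of length two through a new vertex $w$ (one new vertex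 per arc); $I(D)$ denotes the set of new vertices. The subdivision-arc join $D_1\mathbin{\underline{\vee}} D_2$ is obtained from the disjoint union of $\mathcal S(D_1)$ and $D_2$ by adding both arcs $vw$ and $wv$ for every new vertex $v\in I(D_1)$ and every $w\in V(D_2)$. *)

theory Defs
  imports
    "Graph_Theory.Pair_Digraph"
    "Jordan_Normal_Form.Char_Poly"
    "Jordan_Normal_Form.Gauss_Jordan_Elimination"
    "HOL-Computational_Algebra.Fundamental_Theorem_Algebra"
    "HOL-Computational_Algebra.Polynomial_Factorial"
begin

text \<open>Arcs of a pair digraph are ordered pairs of vertices, so there are no multiple arcs;
  \<open>pair_digraph\<close> adds finiteness and the absence of loops.\<close>

definition simple_digraph :: "'a pair_pre_digraph \<Rightarrow> bool" where
  "simple_digraph D \<longleftrightarrow> pair_digraph D \<and> pverts D \<noteq> {}"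

definition vertex_enum :: "'a pair_pre_digraph \<Rightarrow> 'a list \<Rightarrow> bool" where
  "vertex_enum D vs \<longleftrightarrow> distinct vs \<and> set vs = pverts D"

text \<open>The new vertex subdividing the arc \<open>(u, v)\<close> is \<open>Inr (u, v)\<close>.\<close>

definition subdiv_new :: "'a pair_pre_digraph \<Rightarrow> ('a + 'a \<times> 'a) set" where
  "subdiv_new D = Inr ` parcs D"

definition subdiv_digraph :: "'a pair_pre_digraph \<Rightarrow> ('a + 'a \<times> 'a) pair_pre_digraph" where
  "subdiv_digraph D =
     \<lparr> pverts = Inl ` pverts D \<union> subdiv_new D,
       parcs = {(Inl u, Inr (u, v)) |u v. (u, v) \<in> parcs D}
             \<union> {(Inr (u, v), Inl v) |u v. (u, v) \<in> parcs D} \<rparr>"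

definition subdiv_arc_join ::
    "'a pair_pre_digraph \<Rightarrow> 'b pair_pre_digraph \<Rightarrow> (('a + 'a \<times> 'a) + 'b) pair_pre_digraph" where
  "subdiv_arc_join D1 D2 =
     \<lparr> pverts = Inl ` pverts (subdiv_digraph D1) \<union> Inr ` pverts D2,
       parcs = {(Inl x, Inl y) |x y. (x, y) \<in> parcs (subdiv_digraph D1)}
             \<union> {(Inr x, Inr y) |x y. (x, y) \<in> parcs D2}
             \<union> {(Inl v, Inr w) |v w. v \<in> subdiv_new D1 \<and> w \<in> pverts D2}
             \<union> {(Inr w, Inl v) |v w. v \<in> subdiv_new D1 \<and> w \<in> pverts D2} \<rparr>"

lemma subdiv_digraph_simple:
  assumes "simple_digraph D"
  shows "simple_digraph (subdiv_digraph D)"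
proof -
  interpret pair_digraph D
    using assms by (simp add: simple_digraph_def)
  have fin: "finite (parcs (subdiv_digraph D))"
  proof (rule finite_subset)
    show "parcs (subdiv_digraph D) \<subseteq>
      (\<lambda>e. (Inl (fst e), Inr e)) ` parcs D \<union> (\<lambda>e. (Inr e, Inl (snd e))) ` parcs D"
      by (force simp: subdiv_digraph_def)
  qed (simp add: pair_finite_arcs)
  have "pair_digraph (subdiv_digraph D)"
    by unfold_locales
      (use fin in \<open>auto simp: subdiv_digraph_def subdiv_new_def pair_finite_verts pair_finite_arcs
        dest: in_arcsD1 in_arcsD2\<close>)
  then show ?thesis
    using assms by (simp add: simple_digraph_def subdiv_digraph_def)
qed

lemma subdiv_arc_join_simple:
  assumes "simple_digraph D1" "simple_digraph D2"
  shows "simple_digraph (subdiv_arc_join D1 D2)"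
proof -
  interpret S: pair_digraph "subdiv_digraph D1"
    using subdiv_digraph_simple[OF assms(1)] by (simp add: simple_digraph_def)
  interpret D2: pair_digraph D2
    using assms(2) by (simp add: simple_digraph_def)
  have new: "subdiv_new D1 \<subseteq> pverts (subdiv_digraph D1)"
    by (simp add: subdiv_digraph_def)
  have fin: "finite (pverts (subdiv_arc_join D1 D2))"
    by (simp add: subdiv_arc_join_def S.pair_finite_verts D2.pair_finite_verts)
  have wf: "parcs (subdiv_arc_join D1 D2) \<subseteq>
      pverts (subdiv_arc_join D1 D2) \<times> pverts (subdiv_arc_join D1 D2)"
    using new by (auto simp: subdiv_arc_join_def dest: S.in_arcsD1 S.in_arcsD2
        D2.in_arcsD1 D2.in_arcsD2)
  have fin': "finite (parcs (subdiv_arc_join D1 D2))"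
    using finite_subset[OF wf] fin by simp
  have nl: "fst e \<noteq> snd e" if "e \<in> parcs (subdiv_arc_join D1 D2)" for e
    using that by (auto simp: subdiv_arc_join_def dest: S.pair_no_loops D2.pair_no_loops)
  have "pair_digraph (subdiv_arc_join D1 D2)"
    by unfold_locales (use wf fin fin' nl in auto)
  then show ?thesis
    using assms(2) by (auto simp: simple_digraph_def subdiv_arc_join_def)
qed

definition adjacency_mat :: "'a pair_pre_digraph \<Rightarrow> 'a list \<Rightarrow> complex mat" where
  "adjacency_mat D vs = mat (length vs) (length vs)
     (\<lambda>(i, j). if (vs ! i, vs ! j) \<in> parcs D then 1 else 0)"

definition A_spectrum :: "'a pair_pre_digraph \<Rightarrow> 'a list \<Rightarrow> complex multiset" where
  "A_spectrum D vs = proots (char_poly (adjacency_mat D vs))"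

text \<open>The field of rational functions over the complex numbers is \<open>complex poly fract\<close>.\<close>

definition ratfun_X :: "complex poly fract" where
  "ratfun_X = to_fract [:0, 1:]"

definition ratfun_const :: "complex \<Rightarrow> complex poly fract" where
  "ratfun_const c = to_fract [:c:]"

lemma pcompose_square_eq_0_iff [simp]:
  "p \<circ>\<^sub>p [:0, 0, 1:] = 0 \<longleftrightarrow> p = (0 :: complex poly)"
  by (rule pcompose_eq_0_iff) simp

text \<open>\<open>ratfun_square r\<close> is \<open>r\<close> with its variable replaced by its square; the lemma
  \<open>ratfun_square_Fract\<close> shows that the representation chosen does not matter.\<close>

definition ratfun_square :: "complex poly fract \<Rightarrow> complex poly fract" where
  "ratfun_square r = (let (p, q) = (SOME (p, q). q \<noteq> 0 \<and> r = Fract p q)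
     in Fract (p \<circ>\<^sub>p [:0, 0, 1:]) (q \<circ>\<^sub>p [:0, 0, 1:]))"

lemma ratfun_square_Fract:
  assumes "q \<noteq> 0"
  shows "ratfun_square (Fract p q) = Fract (p \<circ>\<^sub>p [:0, 0, 1:]) (q \<circ>\<^sub>p [:0, 0, 1:])"
proof -
  let ?P = "\<lambda>(a, b). b \<noteq> 0 \<and> Fract p q = Fract a b"
  obtain a b where ab: "(SOME (a, b). b \<noteq> 0 \<and> Fract p q = Fract a b) = (a, b)"
    by (cases "SOME (a, b). b \<noteq> 0 \<and> Fract p q = Fract a b") auto
  have "?P (SOME x. ?P x)"
    by (rule someI[of ?P "(p, q)"]) (use assms in auto)
  then have b: "b \<noteq> 0" and "Fract a b = Fract p q"
    by (simp_all add: ab)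
  then have "a * q = p * b"
    using b assms by (simp add: eq_fract)
  then have "(a \<circ>\<^sub>p [:0, 0, 1:]) * (q \<circ>\<^sub>p [:0, 0, 1:]) = (p \<circ>\<^sub>p [:0, 0, 1:]) * (b \<circ>\<^sub>p [:0, 0, 1:])"
    by (simp flip: pcompose_mult)
  then show ?thesis
    using ab b assms by (simp add: ratfun_square_def eq_fract)
qed

text \<open>\<open>mat_inverse\<close> returns an option; \<open>resolvent_mat_invertible\<close> below shows that it is
  never \<open>None\<close> in the use made of it here.\<close>

definition resolvent_mat :: "complex mat \<Rightarrow> complex poly fract mat" where
  "resolvent_mat M =
     the (mat_inverse (ratfun_X \<cdot>\<^sub>m 1\<^sub>m (dim_row M) - map_mat ratfun_const M))"

definition coronal :: "complex mat \<Rightarrow> complex poly fract" where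
  "coronal M = (let one = vec (dim_row M) (\<lambda>_. 1) in one \<bullet> (resolvent_mat M *\<^sub>v one))"

lemma ratfun_char_poly_matrix:
  assumes "M \<in> carrier_mat n n"
  shows "ratfun_X \<cdot>\<^sub>m 1\<^sub>m n - map_mat ratfun_const M = map_mat to_fract (char_poly_matrix M)"
proof (rule eq_matI)
  fix i j
  assume "i < dim_row (map_mat to_fract (char_poly_matrix M))"
    "j < dim_col (map_mat to_fract (char_poly_matrix M))"
  then have ij: "i < n" "j < n" using assms by (auto simp: char_poly_matrix_def)
  have neg: "to_fract [:- c:] = - to_fract [:c:]" for c :: complex
    by (simp flip: to_fract_uminus)
  show "(ratfun_X \<cdot>\<^sub>m 1\<^sub>m n - map_mat ratfun_const M) $$ (i, j) =
      map_mat to_fract (char_poly_matrix M) $$ (i, j)"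
    using ij assms neg[of "M $$ (i, j)"]
    by (auto simp: char_poly_matrix_def ratfun_X_def ratfun_const_def simp flip: to_fract_diff)
qed (use assms in \<open>auto simp: char_poly_matrix_def\<close>)

lemma resolvent_mat_invertible:
  assumes M: "M \<in> carrier_mat n n"
  shows "mat_inverse (ratfun_X \<cdot>\<^sub>m 1\<^sub>m n - map_mat ratfun_const M) = Some (resolvent_mat M)"
proof -
  let ?L = "ratfun_X \<cdot>\<^sub>m 1\<^sub>m n - map_mat ratfun_const M"
  interpret F: comm_ring_hom "to_fract :: complex poly \<Rightarrow> _"
    by unfold_locales (auto simp: to_fract_def One_fract_def Zero_fract_def)
  have L: "?L \<in> carrier_mat n n" using M by auto
  have "char_poly M \<noteq> 0"
    using degree_monic_char_poly[OF M] by auto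
  then have "det ?L \<noteq> 0"
    by (simp add: ratfun_char_poly_matrix[OF M] F.hom_det char_poly_def)
  then have "?L \<in> Units (ring_mat TYPE(complex poly fract) n ())"
    using L by (intro det_non_zero_imp_unit)
  then have "mat_inverse ?L \<noteq> None"
    using mat_inverse(1)[OF L, of "()"] by blast
  then show ?thesis
    using M by (auto simp: resolvent_mat_def)
qed

end

theory Submission
  imports Defs
begin

text \<open>
  Order the vertices of the join as the vertices of \<open>D1\<close>, the new vertices, the vertices of \<open>D2\<close>. Let
  \<open>T\<close> and \<open>H\<close> be the tail and head incidence matrices of \<open>D1\<close>, with vertices indexing the rows of \<open>T\<close>
  and the columns of \<open>H\<close>. Three facts about them are used: \<open>T H\<close> is the adjacency matrix \<open>A1\<close> of
  \<open>D1\<close>, every column of \<open>T\<close> sums to one, and every row of \<open>H\<close> sums to one. Writing \<open>x\<close> for the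
  variable and \<open>A2\<close> for the adjacency matrix of \<open>D2\<close>, the characteristic matrix of the join has block rows
  \<open>(N, - u 1\<^sup>T)\<close> and \<open>(- 1 u\<^sup>T, x - A2)\<close>, where \<open>N\<close> has block rows \<open>(x, - T)\<close> and
  \<open>(- H, x)\<close>, and \<open>u\<close> is the indicator vector of the new vertices.

  The coupling of the two diagonal blocks has rank one, so the determinant is
  \<open>det N * det (x - A2) * (1 - (u\<^sup>T N\<^sup>-\<^sup>1 u) * \<chi>)\<close> with \<open>\<chi>\<close> the coronal of \<open>A2\<close>
  (\<open>det_four_block_mat_coupled\<close>). Elimination in \<open>N\<close> gives \<open>det N = x ^ (m1 - n1) * det (x\<^sup>2 - A1)\<close>
  (\<open>det_subdivision_block\<close>). If \<open>(x\<^sup>2 - A1) w = 1\<close>, then \<open>N\<^sup>-\<^sup>1 u\<close> has the components \<open>A1 w\<close> and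
  \<open>x H w\<close> (\<open>subdivision_block_solution\<close>), whence
  \<open>u\<^sup>T N\<^sup>-\<^sup>1 u = x 1\<^sup>T H w = x 1\<^sup>T A1 w = x (x\<^sup>2 1\<^sup>T w - n1)\<close>, and \<open>1\<^sup>T w\<close> is the coronal of
  \<open>A1\<close> at \<open>x\<^sup>2\<close>. All of this is linear algebra over the field of rational functions; inverses enter only
  as solutions of linear equations.

  For the second claim, the formula contains \<open>n1\<close> and \<open>m1\<close> besides the given data. The number
  \<open>n1\<close> is the degree of the characteristic polynomial of \<open>D1\<close>. The number \<open>m1\<close> is the sum \<open>1\<^sup>T A1 1\<close> of the
  entries of \<open>A1\<close>, which is the coefficient of \<open>x\<^sup>-\<^sup>2\<close> in the expansion of the coronal of \<open>A1\<close> at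
  infinity; a degree estimate expresses this within polynomials (\<open>coronal_expansion\<close>).
\<close>

section \<open>Determinants of block matrices\<close>

text \<open>Adding the second block column times \<open>Z\<close> to the first block column clears the lower left block, and
this column operation has determinant one. When \<open>D\<close> is invertible the condition forces
\<open>Z = - D\<^sup>-\<^sup>1 C\<close>, which makes this the Schur complement formula; giving \<open>Z\<close> instead of an
inverse keeps it usable over any integral domain.\<close>

lemma det_four_block_mat_eliminate:
  fixes A B C D Z :: "'a :: idom mat"
  assumes A: "A \<in> carrier_mat n n" and B: "B \<in> carrier_mat n m"
    and C: "C \<in> carrier_mat m n" and D: "D \<in> carrier_mat m m"
    and Z: "Z \<in> carrier_mat m n" and CDZ: "C + D * Z = 0\<^sub>m m n"
  shows "det (four_block_mat A B C D) = det (A + B * Z) * det D"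
proof -
  let ?E = "four_block_mat (1\<^sub>m n) (0\<^sub>m n m) Z (1\<^sub>m m)"
  have E: "?E \<in> carrier_mat (n + m) (n + m)" by simp
  have M: "four_block_mat A B C D \<in> carrier_mat (n + m) (n + m)" using A D by simp
  have "four_block_mat A B C D * ?E = four_block_mat (A + B * Z) B (0\<^sub>m m n) D"
    using A B C D Z CDZ by (subst mult_four_block_mat[of _ n n _ m _ m _ _ n _ m]) auto
  then have "det (four_block_mat A B C D) * det ?E = det (four_block_mat (A + B * Z) B (0\<^sub>m m n) D)"
    by (simp flip: det_mult[OF M E])
  moreover have "det ?E = 1"
    using Z by (subst det_four_block_mat_upper_right_zero[of _ n _ m]) auto
  moreover have "det (four_block_mat (A + B * Z) B (0\<^sub>m m n) D) = det (A + B * Z) * det D"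
    using A B D Z by (intro det_four_block_mat_lower_left_zero[of _ n _ m]) auto
  ultimately show ?thesis by simp
qed

text \<open>Sylvester's identity: both sides are the determinant of the block matrix with rows \<open>(1, Y)\<close> and
\<open>(V, 1)\<close>, once with the lower left block cleared and once with the upper right one.\<close>

lemma det_one_minus_mult_commute:
  fixes Y V :: "'a :: idom mat"
  assumes Y: "Y \<in> carrier_mat n m" and V: "V \<in> carrier_mat m n"
  shows "det (1\<^sub>m n - Y * V) = det (1\<^sub>m m - V * Y)"
proof -
  let ?M = "four_block_mat (1\<^sub>m n) Y V (1\<^sub>m m)"
  let ?E = "four_block_mat (1\<^sub>m n) (- Y) (0\<^sub>m m n) (1\<^sub>m m)"
  have M: "?M \<in> carrier_mat (n + m) (n + m)" and E: "?E \<in> carrier_mat (n + m) (n + m)" by auto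
  have "det ?M = det (1\<^sub>m n + Y * (- V)) * det (1\<^sub>m m :: 'a mat)"
    using Y V by (intro det_four_block_mat_eliminate) auto
  moreover have "1\<^sub>m n + Y * (- V) = 1\<^sub>m n - Y * V"
    using Y V by (auto simp: add_uminus_minus_mat)
  moreover have "?M * ?E = four_block_mat (1\<^sub>m n) (0\<^sub>m n m) V (1\<^sub>m m - V * Y)"
  proof -
    have "V * (- Y) + 1\<^sub>m m = 1\<^sub>m m - V * Y" "- Y + Y = 0\<^sub>m n m"
      using Y V by auto
    then show ?thesis
      using Y V by (subst mult_four_block_mat[of _ n n _ m _ m _ _ n _ m]) auto
  qed
  moreover have "det (four_block_mat (1\<^sub>m n) (0\<^sub>m n m) V (1\<^sub>m m - V * Y)) = det (1\<^sub>m m - V * Y)"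
    using Y V by (subst det_four_block_mat_upper_right_zero[of _ n _ m]) auto
  moreover have "det ?E = 1"
    using Y by (subst det_four_block_mat_lower_left_zero[of _ n _ m]) auto
  ultimately show ?thesis
    using det_mult[OF M E] by simp
qed

text \<open>Two blocks \<open>N\<close> and \<open>L\<close> that interact only through a factorisation of inner dimension \<open>p\<close> contribute
their own determinants and a correction of size \<open>p\<close>. Clearing the lower left block turns \<open>N\<close> into
\<open>N - U (V W) U'\<close>, which is \<open>N (1 - Y (V W) U')\<close>, and Sylvester's identity moves the second factor down
to size \<open>p\<close>. The join uses \<open>p = 1\<close>, where the correction is a scalar.\<close>

lemma det_four_block_mat_coupled:
  fixes N L U V V' U' Y W :: "'a :: idom mat"
  assumes N: "N \<in> carrier_mat n n" and L: "L \<in> carrier_mat k k"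
    and U: "U \<in> carrier_mat n p" and V: "V \<in> carrier_mat p k"
    and U': "U' \<in> carrier_mat p n" and V': "V' \<in> carrier_mat k p"
    and Y: "Y \<in> carrier_mat n p" and W: "W \<in> carrier_mat k p"
    and NY: "N * Y = U" and LW: "L * W = V'"
  shows "det (four_block_mat N (- (U * V)) (- (V' * U')) L)
       = det N * det L * det (1\<^sub>m p - V * W * (U' * Y))"
proof -
  let ?S = "V * W * U'"
  have S: "?S \<in> carrier_mat p n" using V W U' by simp
  have "det (four_block_mat N (- (U * V)) (- (V' * U')) L)
      = det (N + - (U * V) * (W * U')) * det L"
  proof (rule det_four_block_mat_eliminate)
    have "L * (W * U') = V' * U'"
      using L W U' LW by (simp flip: assoc_mult_mat[of _ k k _ p _ n])
    then show "- (V' * U') + L * (W * U') = 0\<^sub>m k n"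
      using V' U' by simp
  qed (use N L U V U' V' W in auto)
  also have "N + - (U * V) * (W * U') = N * (1\<^sub>m n - Y * ?S)"
  proof -
    have "U * V * (W * U') = U * ?S"
      using U V W U' by (simp add: assoc_mult_mat[of _ n p _ k _ n] assoc_mult_mat[of _ p k _ p _ n])
    also have "\<dots> = N * (Y * ?S)"
      using N Y S NY by (simp flip: assoc_mult_mat[of _ n n _ p _ n])
    finally have *: "U * V * (W * U') = N * (Y * ?S)" .
    have "- (U * V) * (W * U') = - (N * (Y * ?S))"
      unfolding *[symmetric] using U V W U' by (intro uminus_mult_left_mat) auto
    then have "N + - (U * V) * (W * U') = N - N * (Y * ?S)"
      using N Y S by (simp add: add_uminus_minus_mat)
    also have "\<dots> = N * (1\<^sub>m n - Y * ?S)"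
      using N Y S mult_minus_distrib_mat[of N n n "1\<^sub>m n" n "Y * ?S"] by simp
    finally show ?thesis .
  qed
  also have "det (N * (1\<^sub>m n - Y * ?S)) = det N * det (1\<^sub>m n - Y * ?S)"
    by (rule det_mult[OF N minus_carrier_mat[OF mult_carrier_mat[OF Y S]]])
  also have "det (1\<^sub>m n - Y * ?S) = det (1\<^sub>m p - ?S * Y)"
    using Y S by (rule det_one_minus_mult_commute)
  also have "?S * Y = V * W * (U' * Y)"
    using V W U' Y by (intro assoc_mult_mat[of _ p p _ n _ p]) auto
  finally show ?thesis by (simp add: mult.commute mult.left_commute)
qed

section \<open>The block matrix of a subdivided and joined digraph\<close>

definition ones_mat :: "nat \<Rightarrow> nat \<Rightarrow> 'a :: one mat" where
  "ones_mat r c = mat r c (\<lambda>_. 1)"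

lemma ones_mat_carrier [simp]: "ones_mat r c \<in> carrier_mat r c"
  by (simp add: ones_mat_def)

lemma ones_mat_simps [simp]:
  "dim_row (ones_mat r c) = r" "dim_col (ones_mat r c) = c"
  "i < r \<Longrightarrow> j < c \<Longrightarrow> ones_mat r c $$ (i, j) = 1"
  by (simp_all add: ones_mat_def)

lemma smult_uminus_mat: "a \<cdot>\<^sub>m (- A) = - (a \<cdot>\<^sub>m A :: 'a :: comm_ring_1 mat)"
  by (intro eq_matI) auto

lemma uminus_mult_mat:
  "A \<in> carrier_mat a b \<Longrightarrow> B \<in> carrier_mat b c \<Longrightarrow> - A * B = - (A * B :: 'a :: comm_ring_1 mat)"
  by (auto intro: uminus_mult_left_mat)

lemma smult_smult_mat: "a \<cdot>\<^sub>m (b \<cdot>\<^sub>m A) = (a * b :: 'a :: comm_ring_1) \<cdot>\<^sub>m A"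
  by (intro eq_matI) (auto simp: mult_ac)

lemma one_smult_mat: "1 \<cdot>\<^sub>m A = (A :: 'a :: comm_ring_1 mat)"
  by (intro eq_matI) auto

text \<open>The block matrix is \<open>x - S\<close>, where \<open>S\<close> is the adjacency matrix of a subdivision digraph when \<open>B\<close> and \<open>C\<close>
are the tail and head incidence matrices, and the right hand side is the indicator vector of the new
vertices. Eliminating the first component \<open>a = x\<^sup>-\<^sup>1 B b\<close> leaves \<open>(x\<^sup>2 - C B) b = x 1\<close>; since
\<open>C\<close> maps the all-ones vector to the all-ones vector, \<open>b = x C w\<close> solves this as soon as
\<open>(x\<^sup>2 - B C) w = 1\<close>.\<close>

lemma subdivision_block_solution:
  fixes B C w :: "'a :: comm_ring_1 mat"
  assumes B: "B \<in> carrier_mat n m" and C: "C \<in> carrier_mat m n"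
    and w: "w \<in> carrier_mat n 1"
    and C1: "C * ones_mat n 1 = ones_mat m 1"
    and res: "(x\<^sup>2 \<cdot>\<^sub>m 1\<^sub>m n - B * C) * w = ones_mat n 1"
  shows "four_block_mat (x \<cdot>\<^sub>m 1\<^sub>m n) (- B) (- C) (x \<cdot>\<^sub>m 1\<^sub>m m) * (B * C * w @\<^sub>r x \<cdot>\<^sub>m (C * w))
       = 0\<^sub>m n 1 @\<^sub>r ones_mat m 1"
proof -
  have BCw: "x\<^sup>2 \<cdot>\<^sub>m w - B * C * w = ones_mat n 1"
    using res B C w by (simp add: minus_mult_distrib_mat[of _ n n _ _ 1] mult_smult_assoc_mat[of _ n n _ 1])
  have top: "x \<cdot>\<^sub>m (B * C * w) + - (x \<cdot>\<^sub>m (B * C * w)) = 0\<^sub>m n 1"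
    using B C w by auto
  have "C * (x\<^sup>2 \<cdot>\<^sub>m w - B * C * w) = x\<^sup>2 \<cdot>\<^sub>m (C * w) - C * (B * C * w)"
    using B C w by (subst mult_minus_distrib_mat[of _ m n _ 1]) auto
  then have bot: "x\<^sup>2 \<cdot>\<^sub>m (C * w) - C * (B * C * w) = ones_mat m 1"
    by (simp only: BCw C1)
  have r1: "x \<cdot>\<^sub>m 1\<^sub>m n * (B * C * w) + - B * (x \<cdot>\<^sub>m (C * w)) = 0\<^sub>m n 1"
  proof -
    have "- B * (x \<cdot>\<^sub>m (C * w)) = - (x \<cdot>\<^sub>m (B * C * w))"
      using B C w by (simp add: uminus_mult_mat[of _ n m _ 1] smult_uminus_mat mult_smult_distrib[of _ n m _ 1])
    moreover have "x \<cdot>\<^sub>m 1\<^sub>m n * (B * C * w) = x \<cdot>\<^sub>m (B * C * w)"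
      using B C w by (simp add: mult_smult_assoc_mat[of _ n n _ 1])
    ultimately show ?thesis using top by simp
  qed
  have r2: "- C * (B * C * w) + x \<cdot>\<^sub>m 1\<^sub>m m * (x \<cdot>\<^sub>m (C * w)) = ones_mat m 1"
  proof -
    have "- C * (B * C * w) = - (C * (B * C * w))"
      using B C w by (intro uminus_mult_mat) auto
    moreover have "x \<cdot>\<^sub>m 1\<^sub>m m * (x \<cdot>\<^sub>m (C * w)) = x\<^sup>2 \<cdot>\<^sub>m (C * w)"
      using C w by (auto simp: mult_smult_assoc_mat[of _ m m _ 1] power2_eq_square smult_smult_mat)
    moreover have "- (C * (B * C * w)) + x\<^sup>2 \<cdot>\<^sub>m (C * w) = x\<^sup>2 \<cdot>\<^sub>m (C * w) - C * (B * C * w)"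
      using C B w by (intro eq_matI) auto
    ultimately show ?thesis using bot by simp
  qed
  show ?thesis
    unfolding append_rows_def
    using B C w r1 r2
    by (subst mult_four_block_mat[of _ n n _ m _ m _ _ 1 _ 0]) (auto simp: carrier_matD)
qed

text \<open>Clearing the lower left block with \<open>x\<^sup>-\<^sup>1 C\<close> leaves \<open>x - x\<^sup>-\<^sup>1 B C\<close>, which is
\<open>x\<^sup>-\<^sup>1 (x\<^sup>2 - B C)\<close>. Multiplying by \<open>x ^ n\<close> avoids a negative exponent when \<open>m < n\<close>.\<close>

lemma det_subdivision_block:
  fixes B C :: "'a :: field mat"
  assumes B: "B \<in> carrier_mat n m" and C: "C \<in> carrier_mat m n" and x: "x \<noteq> 0"
  shows "x ^ n * det (four_block_mat (x \<cdot>\<^sub>m 1\<^sub>m n) (- B) (- C) (x \<cdot>\<^sub>m 1\<^sub>m m))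
       = x ^ m * det (x\<^sup>2 \<cdot>\<^sub>m 1\<^sub>m n - B * C)"
proof -
  let ?Z = "inverse x \<cdot>\<^sub>m C"
  let ?T = "x \<cdot>\<^sub>m 1\<^sub>m n + - B * ?Z"
  have Z: "x \<cdot>\<^sub>m 1\<^sub>m m * ?Z = C"
    using C x by (simp add: mult_smult_assoc_mat[of _ m m _ n] smult_smult_mat one_smult_mat)
  have "det (four_block_mat (x \<cdot>\<^sub>m 1\<^sub>m n) (- B) (- C) (x \<cdot>\<^sub>m 1\<^sub>m m)) = det ?T * det (x \<cdot>\<^sub>m 1\<^sub>m m)"
    using B C by (intro det_four_block_mat_eliminate) (auto simp: Z)
  moreover have "x ^ n * det ?T = det (x \<cdot>\<^sub>m ?T)"
    using C by simp
  moreover have "x \<cdot>\<^sub>m ?T = x\<^sup>2 \<cdot>\<^sub>m 1\<^sub>m n - B * C"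
  proof -
    have "- B * ?Z = - (inverse x \<cdot>\<^sub>m (B * C))"
      using B C by (simp add: uminus_mult_mat[of _ n m _ n] smult_uminus_mat mult_smult_distrib[of _ n m _ n])
    then show ?thesis
      using B C x by (intro eq_matI) (auto simp: power2_eq_square algebra_simps)
  qed
  ultimately show ?thesis by (simp add: mult.commute mult.left_commute)
qed

lemma ones_mat_mult_ones_mat:
  "ones_mat 1 n * ones_mat n 1 = (mat 1 1 (\<lambda>_. of_nat n) :: 'a :: comm_ring_1 mat)"
  by (intro eq_matI) (auto simp: ones_mat_def scalar_prod_def)

text \<open>The coupling between the two blocks has rank one, so the correction is one minus the product of two
scalars: \<open>1\<^sup>T (x - A2)\<^sup>-\<^sup>1 1\<close> and \<open>U\<^sup>T N\<^sup>-\<^sup>1 U\<close>. By the explicit solution above the latter is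
\<open>x 1\<^sup>T C w1\<close>. As every column of \<open>B\<close> sums to one, \<open>1\<^sup>T C w1 = 1\<^sup>T B C w1\<close>, and the equation for
\<open>w1\<close> turns this into \<open>x\<^sup>2 1\<^sup>T w1 - n\<close>.\<close>

lemma det_subdivision_arc_join:
  fixes B C A2 w1 w2 :: "'a :: field mat"
  assumes B: "B \<in> carrier_mat n m" and C: "C \<in> carrier_mat m n" and A2: "A2 \<in> carrier_mat k k"
    and x: "x \<noteq> 0"
    and B1: "ones_mat 1 n * B = ones_mat 1 m" and C1: "C * ones_mat n 1 = ones_mat m 1"
    and w1: "w1 \<in> carrier_mat n 1" and res1: "(x\<^sup>2 \<cdot>\<^sub>m 1\<^sub>m n - B * C) * w1 = ones_mat n 1"
    and w2: "w2 \<in> carrier_mat k 1" and res2: "(x \<cdot>\<^sub>m 1\<^sub>m k - A2) * w2 = ones_mat k 1"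
  defines "N \<equiv> four_block_mat (x \<cdot>\<^sub>m 1\<^sub>m n) (- B) (- C) (x \<cdot>\<^sub>m 1\<^sub>m m)"
    and "U \<equiv> 0\<^sub>m n 1 @\<^sub>r ones_mat m 1"
  shows "x ^ n * det (four_block_mat N (- (U * ones_mat 1 k)) (- (ones_mat k 1 * U\<^sup>T)) (x \<cdot>\<^sub>m 1\<^sub>m k - A2))
     = x ^ m * det (x\<^sup>2 \<cdot>\<^sub>m 1\<^sub>m n - B * C) * det (x \<cdot>\<^sub>m 1\<^sub>m k - A2)
       * (1 - x * (x\<^sup>2 * (ones_mat 1 n * w1) $$ (0, 0) - of_nat n) * (ones_mat 1 k * w2) $$ (0, 0))"
proof -
  let ?Y = "B * C * w1 @\<^sub>r x \<cdot>\<^sub>m (C * w1)"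
  have U: "U \<in> carrier_mat (n + m) 1" and Y: "?Y \<in> carrier_mat (n + m) 1"
    using B C w1 by (auto simp: U_def)
  have N: "N \<in> carrier_mat (n + m) (n + m)" by (simp add: N_def)
  have UY: "U\<^sup>T * ?Y = x \<cdot>\<^sub>m (ones_mat 1 m * (C * w1))"
  proof -
    have UT: "U\<^sup>T = four_block_mat (0\<^sub>m 1 n) (ones_mat 1 m) (0\<^sub>m 0 n) (0\<^sub>m 0 m)"
      by (intro eq_matI) (auto simp: U_def append_rows_def ones_mat_def)
    show ?thesis
      unfolding UT append_rows_def using B C w1
      by (subst mult_four_block_mat[of _ 1 n _ m _ 0 _ _ 1 _ 0])
        (auto simp: mult_smult_distrib[of _ 1 m _ 1] intro!: eq_matI)
  qed
  have "ones_mat 1 n * B * (C * w1) = ones_mat 1 n * (B * C * w1)"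
    using B C w1 by (simp add: assoc_mult_mat[of _ 1 n _ m _ 1])
  then have "ones_mat 1 m * (C * w1) = ones_mat 1 n * (B * C * w1)"
    by (simp only: B1)
  also have "B * C * w1 = x\<^sup>2 \<cdot>\<^sub>m w1 - ones_mat n 1"
  proof -
    have *: "x\<^sup>2 \<cdot>\<^sub>m w1 - B * C * w1 = ones_mat n 1"
      using res1 B C w1 by (simp add: minus_mult_distrib_mat[of _ n n _ _ 1] mult_smult_assoc_mat[of _ n n _ 1])
    show ?thesis unfolding *[symmetric] using B C w1 by (intro eq_matI) auto
  qed
  also have "ones_mat 1 n * (x\<^sup>2 \<cdot>\<^sub>m w1 - ones_mat n 1)
     = x\<^sup>2 \<cdot>\<^sub>m (ones_mat 1 n * w1) - mat 1 1 (\<lambda>_. of_nat n)"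
    using w1 by (simp add: mult_minus_distrib_mat[of _ 1 n _ 1] mult_smult_distrib[of _ 1 n _ 1] ones_mat_mult_ones_mat[simplified])
  finally have s: "(U\<^sup>T * ?Y) $$ (0, 0) = x * (x\<^sup>2 * (ones_mat 1 n * w1) $$ (0, 0) - of_nat n)"
    using w1 by (simp add: UY)
  have 11: "det (1\<^sub>m 1 - P * Q) = 1 - Q $$ (0, 0) * P $$ (0, 0)"
    if "P \<in> carrier_mat 1 1" "Q \<in> carrier_mat 1 1" for P Q :: "'a mat"
    using that by (subst det_single) (auto simp: scalar_prod_def)
  have "det (four_block_mat N (- (U * ones_mat 1 k)) (- (ones_mat k 1 * U\<^sup>T)) (x \<cdot>\<^sub>m 1\<^sub>m k - A2))
     = det N * det (x \<cdot>\<^sub>m 1\<^sub>m k - A2) * det (1\<^sub>m 1 - ones_mat 1 k * w2 * (U\<^sup>T * ?Y))"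
    using N U Y A2 w2 res2 subdivision_block_solution[OF B C w1 C1 res1]
    by (intro det_four_block_mat_coupled) (auto simp: N_def U_def)
  also have "det (1\<^sub>m 1 - ones_mat 1 k * w2 * (U\<^sup>T * ?Y)) =
     1 - x * (x\<^sup>2 * (ones_mat 1 n * w1) $$ (0, 0) - of_nat n) * (ones_mat 1 k * w2) $$ (0, 0)"
    by (simp only: 11[OF mult_carrier_mat[OF ones_mat_carrier w2]
          mult_carrier_mat[OF transpose_carrier_mat[THEN iffD2, OF U] Y]] s)
  finally show ?thesis
    using det_subdivision_block[OF B C x, folded N_def] by (simp add: mult_ac)
qed

section \<open>Vertex orderings and incidence matrices\<close>

lemma sum_nth_distinct:
  assumes "distinct xs"
  shows "(\<Sum>k = 0..<length xs. g (xs ! k)) = sum g (set xs)"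
  using sum_list_distinct_conv_sum_set[OF assms, of g] by (simp add: sum_list_sum_nth)

text \<open>Two orderings differ by a permutation, and the permutation matrix \<open>Perm\<close> conjugates one adjacency
matrix into the other. This makes it possible to choose a convenient vertex ordering of the join.\<close>

lemma char_poly_adjacency_mat_enum:
  assumes "vertex_enum D vs" and "vertex_enum D vs'"
  shows "char_poly (adjacency_mat D vs) = char_poly (adjacency_mat D vs')"
proof (rule char_poly_similar)
  define n where "n = length vs"
  have d: "distinct vs" "distinct vs'" and S: "set vs' = set vs"
    using assms by (auto simp: vertex_enum_def)
  have n': "length vs' = n"
    using distinct_card[OF d(1)] distinct_card[OF d(2)] S by (simp add: n_def)
  define Perm :: "'a list \<Rightarrow> 'a list \<Rightarrow> complex mat"
    where "Perm = (\<lambda>us ws. mat n n (\<lambda>(i, j). if us ! i = ws ! j then 1 else 0))"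
  \<comment> \<open>Left multiplication by \<open>Perm us ws\<close> reindexes the rows from \<open>ws\<close> to \<open>us\<close>.\<close>
  have mult: "(Perm us ws * mat n n (\<lambda>(i, j). g (ws ! i) j)) $$ (i, j) = g (us ! i) j"
    if "distinct ws" "length us = n" "length ws = n" "set us = set ws" "i < n" "j < n" for us ws g i j
  proof -
    have "(Perm us ws * mat n n (\<lambda>(i, j). g (ws ! i) j)) $$ (i, j)
        = (\<Sum>k = 0..<length ws. if us ! i = ws ! k then g (ws ! k) j else 0)"
      using that by (auto simp: Perm_def scalar_prod_def intro!: sum.cong)
    also have "\<dots> = (\<Sum>v \<in> set ws. if us ! i = v then g v j else 0)"
      using that(1) by (rule sum_nth_distinct)
    also have "\<dots> = g (us ! i) j"
      using that nth_mem[of i us] by simp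
    finally show ?thesis .
  qed
  have inv: "Perm us ws * Perm ws us = 1\<^sub>m n"
    if "distinct us" "distinct ws" "length us = n" "length ws = n" "set us = set ws" for us ws
  proof (rule eq_matI)
    fix i j assume "i < dim_row (1\<^sub>m n :: complex mat)" "j < dim_col (1\<^sub>m n :: complex mat)"
    then have "i < n" "j < n" by auto
    then show "(Perm us ws * Perm ws us) $$ (i, j) = 1\<^sub>m n $$ (i, j)"
      using mult[of ws us i j "\<lambda>v j. if v = us ! j then 1 else 0"] that
      by (simp add: Perm_def nth_eq_iff_index_eq)
  qed (auto simp: Perm_def)
  have "adjacency_mat D vs * Perm vs vs' = Perm vs vs' * adjacency_mat D vs'"
  proof (rule eq_matI)
    fix i j
    assume "i < dim_row (Perm vs vs' * adjacency_mat D vs')"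
      "j < dim_col (Perm vs vs' * adjacency_mat D vs')"
    then have ij: "i < n" "j < n" by (auto simp: Perm_def adjacency_mat_def n')
    have "(adjacency_mat D vs * Perm vs vs') $$ (i, j)
        = (\<Sum>k = 0..<length vs. if vs ! k = vs' ! j then if (vs ! i, vs ! k) \<in> parcs D then 1 else 0 else 0)"
      using ij by (auto simp: Perm_def adjacency_mat_def n_def scalar_prod_def intro!: sum.cong)
    also have "\<dots> = (\<Sum>v \<in> set vs. if v = vs' ! j then if (vs ! i, v) \<in> parcs D then 1 else 0 else 0)"
      using d(1) by (rule sum_nth_distinct)
    also have "\<dots> = (if (vs ! i, vs' ! j) \<in> parcs D then 1 else 0)"
      using ij S n' nth_mem[of j vs'] by simp
    also have "\<dots> = (Perm vs vs' * adjacency_mat D vs') $$ (i, j)"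
      using mult[of vs' vs i j "\<lambda>v j. if (v, vs' ! j) \<in> parcs D then 1 else 0"] d S n' ij
      by (simp add: adjacency_mat_def n_def)
    finally show "(adjacency_mat D vs * Perm vs vs') $$ (i, j)
        = (Perm vs vs' * adjacency_mat D vs') $$ (i, j)" .
  qed (auto simp: Perm_def adjacency_mat_def n_def n')
  moreover have c: "adjacency_mat D vs \<in> carrier_mat n n" "adjacency_mat D vs' \<in> carrier_mat n n"
    "Perm us ws \<in> carrier_mat n n" for us ws
    by (auto simp: Perm_def adjacency_mat_def n_def n')
  ultimately have "Perm vs vs' * adjacency_mat D vs' * Perm vs' vs
     = adjacency_mat D vs * (Perm vs vs' * Perm vs' vs)"
    using assoc_mult_mat[OF c(1) c(3) c(3), of vs vs' vs' vs] by simp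
  then have "adjacency_mat D vs = Perm vs vs' * adjacency_mat D vs' * Perm vs' vs"
    using c d S n' by (simp add: inv n_def)
  then show "similar_mat (adjacency_mat D vs) (adjacency_mat D vs')"
    using c d S n' by (intro similar_matI[where P = "Perm vs vs'" and Q = "Perm vs' vs" and n = n])
      (auto simp: inv n_def)
qed

definition tail_mat :: "'a list \<Rightarrow> ('a \<times> 'a) list \<Rightarrow> 'f :: zero_neq_one mat" where
  "tail_mat vs es = mat (length vs) (length es) (\<lambda>(i, j). if fst (es ! j) = vs ! i then 1 else 0)"

definition head_mat :: "'a list \<Rightarrow> ('a \<times> 'a) list \<Rightarrow> 'f :: zero_neq_one mat" where
  "head_mat vs es = mat (length es) (length vs) (\<lambda>(i, j). if snd (es ! i) = vs ! j then 1 else 0)"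

lemma incidence_mat_carrier [simp]:
  "tail_mat vs es \<in> carrier_mat (length vs) (length es)"
  "head_mat vs es \<in> carrier_mat (length es) (length vs)"
  by (auto simp: tail_mat_def head_mat_def)

text \<open>The \<open>(u, v)\<close> entry counts the positions of \<open>es\<close> with tail \<open>u\<close> and head \<open>v\<close>. An arc is the pair
of its ends and \<open>es\<close> has no repetitions, so the count is zero or one.\<close>

lemma tail_mat_mult_head_mat:
  assumes "distinct es"
  shows "tail_mat vs es * head_mat vs es
    = (mat (length vs) (length vs) (\<lambda>(i, j). if (vs ! i, vs ! j) \<in> set es then 1 else 0) :: 'f :: comm_ring_1 mat)"
proof (rule eq_matI, goal_cases)
  case (1 i j)
  then have ij: "i < length vs" "j < length vs" by auto
  have "(tail_mat vs es * head_mat vs es :: 'f mat) $$ (i, j)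
      = (\<Sum>k = 0..<length es. if es ! k = (vs ! i, vs ! j) then 1 else 0)"
    using ij by (auto simp: tail_mat_def head_mat_def scalar_prod_def prod_eq_iff intro!: sum.cong)
  also have "\<dots> = (\<Sum>e \<in> set es. if e = (vs ! i, vs ! j) then 1 else 0)"
    using assms by (rule sum_nth_distinct)
  finally show ?case using ij by simp
qed (auto simp: tail_mat_def head_mat_def)

lemma ones_mat_mult_tail_mat:
  assumes "distinct vs" "fst ` set es \<subseteq> set vs"
  shows "ones_mat 1 (length vs) * tail_mat vs es = (ones_mat 1 (length es) :: 'f :: comm_ring_1 mat)"
proof (rule eq_matI, goal_cases)
  case (1 i j)
  then have ij: "i = 0" "j < length es" by auto
  have "(ones_mat 1 (length vs) * tail_mat vs es :: 'f mat) $$ (i, j)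
      = (\<Sum>k = 0..<length vs. if fst (es ! j) = vs ! k then 1 else 0)"
    using ij by (auto simp: tail_mat_def scalar_prod_def intro!: sum.cong)
  also have "\<dots> = (\<Sum>v \<in> set vs. if fst (es ! j) = v then 1 else 0)"
    using assms(1) by (rule sum_nth_distinct)
  finally show ?case using ij assms(2) nth_mem[of j es] by auto
qed (auto simp: tail_mat_def)

lemma head_mat_mult_ones_mat:
  assumes "distinct vs" "snd ` set es \<subseteq> set vs"
  shows "head_mat vs es * ones_mat (length vs) 1 = (ones_mat (length es) 1 :: 'f :: comm_ring_1 mat)"
proof (rule eq_matI, goal_cases)
  case (1 i j)
  then have ij: "j = 0" "i < length es" by auto
  have "(head_mat vs es * ones_mat (length vs) 1 :: 'f mat) $$ (i, j)
      = (\<Sum>k = 0..<length vs. if snd (es ! i) = vs ! k then 1 else 0)"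
    using ij by (auto simp: head_mat_def scalar_prod_def intro!: sum.cong)
  also have "\<dots> = (\<Sum>v \<in> set vs. if snd (es ! i) = v then 1 else 0)"
    using assms(1) by (rule sum_nth_distinct)
  finally show ?case using ij assms(2) nth_mem[of i es] by auto
qed (auto simp: head_mat_def)

lemma ratfun_const_simps [simp]: "ratfun_const 0 = 0" "ratfun_const 1 = 1"
  by (simp_all add: ratfun_const_def flip: one_pCons)

text \<open>The new vertices come second, between the vertices of the two digraphs, so that they are the last
block of the subdivision digraph.\<close>

definition join_enum :: "'a list \<Rightarrow> ('a \<times> 'a) list \<Rightarrow> 'b list \<Rightarrow> (('a + 'a \<times> 'a) + 'b) list" where
  "join_enum vs1 es vs2 = map (Inl \<circ> Inl) vs1 @ map (Inl \<circ> Inr) es @ map Inr vs2"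

lemma vertex_enum_join_enum:
  assumes "vertex_enum D1 vs1" "vertex_enum D2 vs2" "distinct es" "set es = parcs D1"
  shows "vertex_enum (subdiv_arc_join D1 D2) (join_enum vs1 es vs2)"
  using assms
  by (auto simp: vertex_enum_def join_enum_def subdiv_arc_join_def subdiv_digraph_def subdiv_new_def
      distinct_map inj_on_def image_Un image_image)

lemma parcs_subdiv_arc_join:
  "(Inl (Inl u), Inl (Inl v)) \<notin> parcs (subdiv_arc_join D1 D2)"
  "(Inl (Inl u), Inl (Inr e)) \<in> parcs (subdiv_arc_join D1 D2) \<longleftrightarrow> e \<in> parcs D1 \<and> fst e = u"
  "(Inl (Inl u), Inr w) \<notin> parcs (subdiv_arc_join D1 D2)"
  "(Inl (Inr e), Inl (Inl v)) \<in> parcs (subdiv_arc_join D1 D2) \<longleftrightarrow> e \<in> parcs D1 \<and> snd e = v"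
  "(Inl (Inr e), Inl (Inr e')) \<notin> parcs (subdiv_arc_join D1 D2)"
  "(Inl (Inr e), Inr w) \<in> parcs (subdiv_arc_join D1 D2) \<longleftrightarrow> e \<in> parcs D1 \<and> w \<in> pverts D2"
  "(Inr w, Inl (Inl v)) \<notin> parcs (subdiv_arc_join D1 D2)"
  "(Inr w, Inl (Inr e)) \<in> parcs (subdiv_arc_join D1 D2) \<longleftrightarrow> e \<in> parcs D1 \<and> w \<in> pverts D2"
  "(Inr w, Inr w') \<in> parcs (subdiv_arc_join D1 D2) \<longleftrightarrow> (w, w') \<in> parcs D2"
  by (auto simp: subdiv_arc_join_def subdiv_digraph_def subdiv_new_def prod_eq_iff)

text \<open>\<open>U\<close> is the indicator column of the new vertices among the vertices of the subdivision digraph, so the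
all-ones blocks between new vertices and the second digraph are products of a column and a row.\<close>

lemma ratfun_adjacency_mat_join:
  fixes D1 :: "'a pair_pre_digraph" and D2 :: "'b pair_pre_digraph"
  assumes e1: "vertex_enum D1 vs1" and e2: "vertex_enum D2 vs2" and es: "set es = parcs D1"
  defines "n \<equiv> length vs1" and "m \<equiv> length es" and "k \<equiv> length vs2"
  defines "U \<equiv> 0\<^sub>m n 1 @\<^sub>r ones_mat m 1"
  shows "ratfun_X \<cdot>\<^sub>m 1\<^sub>m (n + m + k)
       - map_mat ratfun_const (adjacency_mat (subdiv_arc_join D1 D2) (join_enum vs1 es vs2))
     = four_block_mat
        (four_block_mat (ratfun_X \<cdot>\<^sub>m 1\<^sub>m n) (- tail_mat vs1 es) (- head_mat vs1 es) (ratfun_X \<cdot>\<^sub>m 1\<^sub>m m))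
        (- (U * ones_mat 1 k)) (- (ones_mat k 1 * U\<^sup>T))
        (ratfun_X \<cdot>\<^sub>m 1\<^sub>m k - map_mat ratfun_const (adjacency_mat D2 vs2))"
    (is "?L = ?R")
proof (rule eq_matI)
  have U: "U \<in> carrier_mat (n + m) 1" by (auto simp: U_def)
  have U1: "(U * ones_mat 1 k) $$ (i, j) = (if i < n then 0 else 1)" if "i < n + m" "j < k" for i j
    using that by (auto simp: U_def append_rows_def scalar_prod_def)
  have U2: "(ones_mat k 1 * U\<^sup>T) $$ (j, i) = (if i < n then 0 else 1)" if "i < n + m" "j < k" for i j
    using that by (auto simp: U_def append_rows_def scalar_prod_def)
  have len: "length (join_enum vs1 es vs2) = n + m + k"
    by (simp add: join_enum_def n_def m_def k_def)
  have v2: "vs2 ! j \<in> pverts D2" if "j < k" for j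
    using that e2 nth_mem[of j vs2] by (auto simp: vertex_enum_def k_def)
  have e: "es ! j \<in> parcs D1" if "j < m" for j
    using that es nth_mem[of j es] by (auto simp: m_def)
  show "dim_row ?L = dim_row ?R" "dim_col ?L = dim_col ?R"
    by (auto simp: adjacency_mat_def len k_def)
  fix i j
  assume "i < dim_row ?R" "j < dim_col ?R"
  then have ij: "i < n + m + k" "j < n + m + k"
    by (auto simp: adjacency_mat_def k_def)
  have nth: "join_enum vs1 es vs2 ! i = (if i < n then Inl (Inl (vs1 ! i))
      else if i < n + m then Inl (Inr (es ! (i - n))) else Inr (vs2 ! (i - (n + m))))"
    if "i < n + m + k" for i
    using that by (auto simp: join_enum_def nth_append n_def m_def k_def)
  have L: "?L $$ (i, j) = (if i = j then ratfun_X else 0)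
      - (if (join_enum vs1 es vs2 ! i, join_enum vs1 es vs2 ! j) \<in> parcs (subdiv_arc_join D1 D2) then 1 else 0)"
    using ij by (simp add: adjacency_mat_def len)
  consider "i < n" | "n \<le> i" "i < n + m" "i - n < m" | "n + m \<le> i" "i - (n + m) < k"
    using ij by linarith
  then show "?L $$ (i, j) = ?R $$ (i, j)"
  proof cases
    case i: 1
    consider "j < n" | "n \<le> j" "j < n + m" "j - n < m" | "n + m \<le> j" "j - (n + m) < k"
      using ij by linarith
    then show ?thesis
      unfolding L nth[OF ij(1)] nth[OF ij(2)]
      using ij i e[of "j - n"] carrier_matD[OF U]
      by cases (auto simp add: parcs_subdiv_arc_join adjacency_mat_def tail_mat_def n_def m_def k_def U1[unfolded k_def] simp del: index_mult_mat(1) One_nat_def)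
  next
    case i: 2
    consider "j < n" | "n \<le> j" "j < n + m" "j - n < m" | "n + m \<le> j" "j - (n + m) < k"
      using ij by linarith
    then show ?thesis
      unfolding L nth[OF ij(1)] nth[OF ij(2)]
      using ij i e[of "i - n"] v2[of "j - (n + m)"] carrier_matD[OF U]
      by cases (auto simp add: parcs_subdiv_arc_join adjacency_mat_def head_mat_def n_def m_def k_def U1[unfolded k_def] simp del: index_mult_mat(1) One_nat_def)
  next
    case i: 3
    consider "j < n" | "n \<le> j" "j < n + m" "j - n < m" | "n + m \<le> j" "j - (n + m) < k"
      using ij by linarith
    then show ?thesis
      unfolding L nth[OF ij(1)] nth[OF ij(2)]
      using ij i e[of "j - n"] v2[of "i - (n + m)"] carrier_matD[OF U]
      by cases (auto simp add: parcs_subdiv_arc_join adjacency_mat_def n_def m_def k_def U2[unfolded k_def] simp del: index_mult_mat(1) One_nat_def)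
  qed
qed

section \<open>Coronals as solutions of linear equations\<close>

text \<open>A solution of one linear equation is all that the determinant computation needs from the inverse
matrix in the definition of the coronal.\<close>

lemma coronal_solution:
  assumes A: "A \<in> carrier_mat n n"
  obtains w where "w \<in> carrier_mat n 1"
    and "(ratfun_X \<cdot>\<^sub>m 1\<^sub>m n - map_mat ratfun_const A) * w = ones_mat n 1"
    and "coronal A = (ones_mat 1 n * w) $$ (0, 0)"
proof -
  let ?L = "ratfun_X \<cdot>\<^sub>m 1\<^sub>m n - map_mat ratfun_const A"
  have L: "?L \<in> carrier_mat n n" using A by auto
  have R: "?L * resolvent_mat A = 1\<^sub>m n" "resolvent_mat A \<in> carrier_mat n n"
    using mat_inverse(2)[OF L resolvent_mat_invertible[OF A]] by auto
  show thesis
  proof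
    show "resolvent_mat A * ones_mat n 1 \<in> carrier_mat n 1" using R by simp
    show "?L * (resolvent_mat A * ones_mat n 1) = ones_mat n 1"
      using L R by (simp flip: assoc_mult_mat[of _ n n _ n _ 1])
    have "row (ones_mat 1 n) 0 = (vec n (\<lambda>_. 1) :: complex poly fract vec)"
      "col (ones_mat n 1) 0 = (vec n (\<lambda>_. 1) :: complex poly fract vec)"
      by (auto simp: ones_mat_def)
    note this[simplified]
    then show "coronal A = (ones_mat 1 n * (resolvent_mat A * ones_mat n 1)) $$ (0, 0)"
      using A R by (simp add: coronal_def Let_def col_mult2[of _ n n _ 1])
  qed
qed

section \<open>Substituting the square of the variable\<close>

text \<open>As a field homomorphism, the substitution commutes with determinants and matrix products. It thus
carries the characteristic polynomial and the coronal of \<open>A\<close> at the variable to the determinant and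
the linear equation of \<open>x\<^sup>2 - A\<close>.\<close>

lemma ratfun_square_hom: "field_hom ratfun_square"
proof
  show "ratfun_square 0 = 0"
    using ratfun_square_Fract[of 1 0] by (simp add: Zero_fract_def pcompose_1)
  show "ratfun_square 1 = 1"
    using ratfun_square_Fract[of 1 1] by (simp add: One_fract_def pcompose_1)
  fix r s :: "complex poly fract"
  obtain a b where r: "r = Fract a b" "b \<noteq> 0" by (cases r) auto
  obtain c d where s: "s = Fract c d" "d \<noteq> 0" by (cases s) auto
  show "ratfun_square (r + s) = ratfun_square r + ratfun_square s"
    using r s by (simp add: ratfun_square_Fract pcompose_add pcompose_mult)
  show "ratfun_square (r * s) = ratfun_square r * ratfun_square s"
    using r s by (simp add: ratfun_square_Fract pcompose_mult)
qed

lemma ratfun_square_to_fract: "ratfun_square (to_fract p) = to_fract (p \<circ>\<^sub>p [:0, 0, 1:])"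
  using ratfun_square_Fract[of 1 p] by (simp add: to_fract_def pcompose_1)

lemma ratfun_square_X: "ratfun_square ratfun_X = ratfun_X\<^sup>2"
  by (simp add: ratfun_X_def ratfun_square_to_fract pcompose_pCons power2_eq_square flip: to_fract_mult)

lemma ratfun_square_const: "ratfun_square (ratfun_const c) = ratfun_const c"
  by (simp add: ratfun_const_def ratfun_square_to_fract)

lemma to_fract_char_poly:
  assumes "A \<in> carrier_mat n n"
  shows "to_fract (char_poly A) = det (ratfun_X \<cdot>\<^sub>m 1\<^sub>m n - map_mat ratfun_const A)"
proof -
  interpret F: comm_ring_hom "to_fract :: complex poly \<Rightarrow> _"
    by unfold_locales (auto simp: to_fract_def One_fract_def Zero_fract_def)
  show ?thesis
    by (simp add: ratfun_char_poly_matrix[OF assms] char_poly_def F.hom_det)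
qed

lemma map_mat_ratfun_square_resolvent:
  assumes "A \<in> carrier_mat n n"
  shows "map_mat ratfun_square (ratfun_X \<cdot>\<^sub>m 1\<^sub>m n - map_mat ratfun_const A)
    = ratfun_X\<^sup>2 \<cdot>\<^sub>m 1\<^sub>m n - map_mat ratfun_const A"
proof -
  interpret S: field_hom ratfun_square by (rule ratfun_square_hom)
  show ?thesis
    using assms by (intro eq_matI) (auto simp: S.hom_minus ratfun_square_X ratfun_square_const)
qed

lemma char_poly_square_eq_det:
  assumes "A \<in> carrier_mat n n"
  shows "to_fract (char_poly A \<circ>\<^sub>p [:0, 0, 1:]) = det (ratfun_X\<^sup>2 \<cdot>\<^sub>m 1\<^sub>m n - map_mat ratfun_const A)"
proof -
  interpret S: field_hom ratfun_square by (rule ratfun_square_hom)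
  have "to_fract (char_poly A \<circ>\<^sub>p [:0, 0, 1:]) = ratfun_square (to_fract (char_poly A))"
    by (simp add: ratfun_square_to_fract)
  also have "\<dots> = det (ratfun_X\<^sup>2 \<cdot>\<^sub>m 1\<^sub>m n - map_mat ratfun_const A)"
    unfolding to_fract_char_poly[OF assms] map_mat_ratfun_square_resolvent[OF assms, symmetric]
    by (rule S.hom_det[symmetric])
  finally show ?thesis .
qed

lemma coronal_square_solution:
  assumes A: "A \<in> carrier_mat n n"
  obtains w where "w \<in> carrier_mat n 1"
    and "(ratfun_X\<^sup>2 \<cdot>\<^sub>m 1\<^sub>m n - map_mat ratfun_const A) * w = ones_mat n 1"
    and "ratfun_square (coronal A) = (ones_mat 1 n * w) $$ (0, 0)"
proof -
  interpret S: field_hom ratfun_square by (rule ratfun_square_hom)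
  let ?L = "ratfun_X \<cdot>\<^sub>m 1\<^sub>m n - map_mat ratfun_const A"
  have L: "?L \<in> carrier_mat n n" using A by auto
  have ones: "map_mat ratfun_square (ones_mat r c) = ones_mat r c" for r c
    by (intro eq_matI) auto
  obtain w where w: "w \<in> carrier_mat n 1" and Lw: "?L * w = ones_mat n 1"
    and c: "coronal A = (ones_mat 1 n * w) $$ (0, 0)"
    using coronal_solution[OF A] .
  show thesis
  proof
    show "map_mat ratfun_square w \<in> carrier_mat n 1" using w by simp
    show "(ratfun_X\<^sup>2 \<cdot>\<^sub>m 1\<^sub>m n - map_mat ratfun_const A) * map_mat ratfun_square w = ones_mat n 1"
      using S.mat_hom_mult[OF L w] by (simp add: Lw ones map_mat_ratfun_square_resolvent[OF A])
    have "map_mat ratfun_square (ones_mat 1 n * w) = ones_mat 1 n * map_mat ratfun_square w"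
      using S.mat_hom_mult[OF ones_mat_carrier w] by (simp add: ones)
    then show "ratfun_square (coronal A) = (ones_mat 1 n * map_mat ratfun_square w) $$ (0, 0)"
      using w by (simp add: c flip: \<open>map_mat ratfun_square (ones_mat 1 n * w) = _\<close> del: One_nat_def)
  qed
qed

section \<open>The characteristic polynomial of the join\<close>

lemma map_adjacency_mat:
  assumes "distinct es" "set es = parcs D" and "h 0 = 0" "h 1 = 1"
  shows "map_mat h (adjacency_mat D vs) = (tail_mat vs es * head_mat vs es :: 'f :: comm_ring_1 mat)"
  unfolding tail_mat_mult_head_mat[OF assms(1)] using assms
  by (intro eq_matI) (auto simp: adjacency_mat_def)

lemma adjacency_mat_carrier: "adjacency_mat D vs \<in> carrier_mat (length vs) (length vs)"
  by (simp add: adjacency_mat_def)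

lemma simple_digraph_arc_list:
  assumes "simple_digraph D" and "vertex_enum D vs"
  obtains es where "distinct es" "set es = parcs D" "length es = card (parcs D)"
    "fst ` set es \<subseteq> set vs" "snd ` set es \<subseteq> set vs"
proof -
  interpret pair_digraph D using assms(1) by (simp add: simple_digraph_def)
  obtain es where es: "set es = parcs D" "distinct es"
    using finite_distinct_list[OF pair_finite_arcs] by blast
  show thesis
  proof (rule that[of es])
    show "fst ` set es \<subseteq> set vs" "snd ` set es \<subseteq> set vs"
      using assms(2) es by (auto simp: vertex_enum_def dest: in_arcsD1 in_arcsD2)
  qed (use es distinct_card[of es] in auto)
qed

lemma vertex_enum_length: "vertex_enum D vs \<Longrightarrow> length vs = card (pverts D)"
  using distinct_card[of vs] by (simp add: vertex_enum_def)

lemma char_poly_subdiv_arc_join: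
  fixes D1 :: "'a pair_pre_digraph" and D2 :: "'b pair_pre_digraph"
  assumes s1: "simple_digraph D1"
    and e1: "vertex_enum D1 vs1" and e2: "vertex_enum D2 vs2"
    and e: "vertex_enum (subdiv_arc_join D1 D2) vs"
  shows "to_fract (char_poly (adjacency_mat (subdiv_arc_join D1 D2) vs)) =
        ratfun_X powi (int (card (parcs D1)) - int (card (pverts D1)))
        * to_fract (char_poly (adjacency_mat D1 vs1) \<circ>\<^sub>p [:0, 0, 1:])
        * to_fract (char_poly (adjacency_mat D2 vs2))
        * (1 - ratfun_X
             * (ratfun_X ^ 2 * ratfun_square (coronal (adjacency_mat D1 vs1)) - of_nat (card (pverts D1)))
             * coronal (adjacency_mat D2 vs2))"
    (is "?F = _ powi (int ?m - int ?n) * ?f1 * ?f2 * ?b")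
proof -
  obtain es where es: "distinct es" "set es = parcs D1" and m: "length es = ?m"
    and inc: "fst ` set es \<subseteq> set vs1" "snd ` set es \<subseteq> set vs1"
    using simple_digraph_arc_list[OF s1 e1] .
  have n: "length vs1 = ?n" using e1 by (rule vertex_enum_length)
  have d1: "distinct vs1" using e1 by (simp add: vertex_enum_def)
  let ?A1 = "adjacency_mat D1 vs1" and ?A2 = "adjacency_mat D2 vs2"
  let ?B = "tail_mat vs1 es :: complex poly fract mat" and ?C = "head_mat vs1 es :: complex poly fract mat"
  let ?k = "length vs2"
  let ?us = "join_enum vs1 es vs2"
  have BC: "map_mat ratfun_const ?A1 = ?B * ?C"
    using es by (intro map_adjacency_mat) auto
  have A1: "?A1 \<in> carrier_mat ?n ?n" and A2: "?A2 \<in> carrier_mat ?k ?k"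
    using adjacency_mat_carrier[of D1 vs1] adjacency_mat_carrier[of D2 vs2] by (simp_all add: n)
  have B: "?B \<in> carrier_mat ?n ?m" and C: "?C \<in> carrier_mat ?m ?n"
    using incidence_mat_carrier[of vs1 es] by (simp_all add: n m)
  have X: "ratfun_X \<noteq> 0" by (simp add: ratfun_X_def)
  have us: "vertex_enum (subdiv_arc_join D1 D2) ?us"
    using e1 e2 es by (rule vertex_enum_join_enum)
  have len: "length ?us = ?n + ?m + ?k" by (simp add: join_enum_def n m)
  have us_carrier: "adjacency_mat (subdiv_arc_join D1 D2) ?us \<in> carrier_mat (?n + ?m + ?k) (?n + ?m + ?k)"
    using adjacency_mat_carrier[of _ ?us] unfolding len .
  obtain w1 where w1: "w1 \<in> carrier_mat ?n 1" "(ratfun_X\<^sup>2 \<cdot>\<^sub>m 1\<^sub>m ?n - ?B * ?C) * w1 = ones_mat ?n 1"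
      "ratfun_square (coronal ?A1) = (ones_mat 1 ?n * w1) $$ (0, 0)"
    using coronal_square_solution[OF A1] unfolding BC .
  obtain w2 where w2: "w2 \<in> carrier_mat ?k 1"
      "(ratfun_X \<cdot>\<^sub>m 1\<^sub>m ?k - map_mat ratfun_const ?A2) * w2 = ones_mat ?k 1"
      "coronal ?A2 = (ones_mat 1 ?k * w2) $$ (0, 0)"
    using coronal_solution[OF A2] .
  have "?F = det (ratfun_X \<cdot>\<^sub>m 1\<^sub>m (?n + ?m + ?k) - map_mat ratfun_const (adjacency_mat (subdiv_arc_join D1 D2) ?us))"
    by (simp only: char_poly_adjacency_mat_enum[OF e us] to_fract_char_poly[OF us_carrier])
  also have "\<dots> = det (four_block_mat
        (four_block_mat (ratfun_X \<cdot>\<^sub>m 1\<^sub>m ?n) (- ?B) (- ?C) (ratfun_X \<cdot>\<^sub>m 1\<^sub>m ?m))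
        (- ((0\<^sub>m ?n 1 @\<^sub>r ones_mat ?m 1) * ones_mat 1 ?k)) (- (ones_mat ?k 1 * (0\<^sub>m ?n 1 @\<^sub>r ones_mat ?m 1)\<^sup>T))
        (ratfun_X \<cdot>\<^sub>m 1\<^sub>m ?k - map_mat ratfun_const ?A2))"
    using ratfun_adjacency_mat_join[OF e1 e2 es(2)] by (simp only: n m)
  finally have F: "?F = \<dots>" .
  have B1: "ones_mat 1 ?n * ?B = ones_mat 1 ?m"
    using ones_mat_mult_tail_mat[OF d1 inc(1)] by (simp only: n m)
  have C1: "?C * ones_mat ?n 1 = ones_mat ?m 1"
    using head_mat_mult_ones_mat[OF d1 inc(2)] by (simp only: n m)
  have A2': "map_mat ratfun_const ?A2 \<in> carrier_mat ?k ?k"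
    using A2 by simp
  have "ratfun_X ^ ?n * ?F = ratfun_X ^ ?m * ?f1 * ?f2 * ?b"
    unfolding F to_fract_char_poly[OF A2] char_poly_square_eq_det[OF A1] BC w1(3) w2(3)
    by (rule det_subdivision_arc_join[OF B C A2' X B1 C1 w1(1,2) w2(1,2)])
  then show ?thesis
    using X by (simp add: power_int_diff field_simps)
qed

section \<open>The number of arcs is determined by the coronal\<close>

lemma coronal_mult_eqI:
  assumes A: "A \<in> carrier_mat n n" and v: "v \<in> carrier_mat n 1"
    and eq: "(ratfun_X \<cdot>\<^sub>m 1\<^sub>m n - map_mat ratfun_const A) * v = c \<cdot>\<^sub>m ones_mat n 1"
  shows "(ones_mat 1 n * v) $$ (0, 0) = c * coronal A"
proof -
  let ?L = "ratfun_X \<cdot>\<^sub>m 1\<^sub>m n - map_mat ratfun_const A"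
  have L: "?L \<in> carrier_mat n n" using A by auto
  have R: "resolvent_mat A * ?L = 1\<^sub>m n" "resolvent_mat A \<in> carrier_mat n n"
    using mat_inverse(2)[OF L resolvent_mat_invertible[OF A]] by auto
  obtain w where w: "w \<in> carrier_mat n 1" and Lw: "?L * w = ones_mat n 1"
    and c: "coronal A = (ones_mat 1 n * w) $$ (0, 0)"
    using coronal_solution[OF A] .
  have "?L * (c \<cdot>\<^sub>m w) = ?L * v"
    using L w by (simp only: eq mult_smult_distrib[of _ n n _ 1] Lw)
  then have "resolvent_mat A * ?L * (c \<cdot>\<^sub>m w) = resolvent_mat A * ?L * v"
    using assoc_mult_mat[OF R(2) L v] assoc_mult_mat[OF R(2) L smult_carrier_mat[OF w]] by simp
  then have "v = c \<cdot>\<^sub>m w"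
    unfolding R(1) using w v by simp
  then show ?thesis
    using w by (simp add: c mult_smult_distrib[of _ 1 n _ 1] del: One_nat_def)
qed

abbreviation const_mat :: "complex mat \<Rightarrow> complex poly mat" where
  "const_mat \<equiv> map_mat (\<lambda>a. [:a:])"

text \<open>Multiplication by a constant matrix does not raise degrees.\<close>

lemma degree_const_mat_mult_less:
  assumes "p \<in> carrier_mat n 1" "M \<in> carrier_mat r n" "0 < d" "\<And>i. i < n \<Longrightarrow> degree (p $$ (i, 0)) < d" "i < r"
  shows "degree ((const_mat M * p) $$ (i, 0)) < d"
proof -
  have "(const_mat M * p) $$ (i, 0) = (\<Sum>k = 0..<n. [:M $$ (i, k):] * p $$ (k, 0))"
    using assms by (auto simp: scalar_prod_def intro!: sum.cong)
  also have "degree \<dots> < d"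
    using assms(3,4) by (intro degree_sum_less) (auto intro: le_less_trans[OF degree_smult_le])
  finally show ?thesis .
qed

text \<open>Over the polynomial ring the adjugate replaces the inverse: \<open>p\<close> is the adjugate of
\<open>x - A\<close> applied to the all-ones vector, so \<open>p / f\<close> is the resolvent applied to it, where \<open>f\<close> is the
characteristic polynomial. The degree bound says that \<open>p / f\<close> vanishes at infinity. It follows from
\<open>x p = f 1 + A p\<close>: if the largest degree \<open>d\<close> of an entry of \<open>p\<close> were at least \<open>n\<close>, the left side would
have an entry of degree \<open>d + 1\<close>, while no entry on the right has degree above \<open>d\<close>.\<close>

lemma coronal_numerator:
  assumes A: "A \<in> carrier_mat n n"
  obtains p where "p \<in> carrier_mat n 1"
    and "[:0, 1:] \<cdot>\<^sub>m p - const_mat A * p = char_poly A \<cdot>\<^sub>m ones_mat n 1"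
    and "\<And>i. i < n \<Longrightarrow> degree (p $$ (i, 0)) < n"
    and "to_fract ((ones_mat 1 n * p) $$ (0, 0)) = to_fract (char_poly A) * coronal A"
proof -
  interpret F: comm_ring_hom "to_fract :: complex poly \<Rightarrow> _"
    by unfold_locales (auto simp: to_fract_def One_fract_def Zero_fract_def)
  let ?X = "[:0, 1:] :: complex poly" and ?f = "char_poly A"
  define p where "p = adj_mat (char_poly_matrix A) * ones_mat n 1"
  have K: "char_poly_matrix A \<in> carrier_mat n n" using A by simp
  have p: "p \<in> carrier_mat n 1" using adj_mat(1)[OF K] by (simp add: p_def)
  have Kp: "char_poly_matrix A * p = ?f \<cdot>\<^sub>m ones_mat n 1"
    using adj_mat[OF K] K
    by (simp add: p_def char_poly_def mult_smult_assoc_mat[of _ n n _ 1] flip: assoc_mult_mat[of _ n n _ n _ 1])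
  have "char_poly_matrix A = ?X \<cdot>\<^sub>m 1\<^sub>m n - const_mat A"
    using A by (intro eq_matI) (auto simp: char_poly_matrix_def)
  then have eq: "?X \<cdot>\<^sub>m p - const_mat A * p = ?f \<cdot>\<^sub>m ones_mat n 1"
    using Kp A p by (simp add: minus_mult_distrib_mat[of _ n n _ _ 1] mult_smult_assoc_mat[of _ n n _ 1])
  have deg: "degree (p $$ (i, 0)) < n" if "i < n" for i
  proof -
    define d where "d = Max ((\<lambda>i. degree (p $$ (i, 0))) ` {..<n})"
    have le: "degree (p $$ (i, 0)) \<le> d" if "i < n" for i
      using that by (auto simp: d_def intro!: Max_ge)
    have "d \<in> (\<lambda>i. degree (p $$ (i, 0))) ` {..<n}"
      unfolding d_def using that by (intro Max_in) auto
    then obtain j where j: "j < n" "degree (p $$ (j, 0)) = d" by auto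
    have "d < n"
    proof (rule ccontr)
      assume "\<not> d < n"
      then have d: "n \<le> d" by simp
      with j have nz: "p $$ (j, 0) \<noteq> 0" by auto
      have "(?X \<cdot>\<^sub>m p - const_mat A * p) $$ (j, 0) = ?f"
        using j by (simp add: eq)
      then have "?X * p $$ (j, 0) = ?f + (const_mat A * p) $$ (j, 0)"
        using j p A by (simp add: algebra_simps)
      moreover have "degree (?f + (const_mat A * p) $$ (j, 0)) < Suc d"
        using degree_const_mat_mult_less[OF p A, of "Suc d" j] le j d degree_monic_char_poly[OF A]
        by (intro degree_add_less) (auto simp: less_Suc_eq_le)
      moreover have "degree (?X * p $$ (j, 0)) = Suc d"
        using nz j by (simp add: degree_mult_eq)
      ultimately show False by simp
    qed
    then show ?thesis using le[OF that] by simp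
  qed
  have "map_mat to_fract (char_poly_matrix A) * map_mat to_fract p = to_fract ?f \<cdot>\<^sub>m ones_mat n 1"
    using p by (simp add: F.mat_hom_mult[OF K p, symmetric] Kp) (auto intro!: eq_matI)
  then have "(ones_mat 1 n * map_mat to_fract p) $$ (0, 0) = to_fract ?f * coronal A"
    using p by (intro coronal_mult_eqI[OF A]) (simp_all add: ratfun_char_poly_matrix[OF A])
  moreover have "(ones_mat 1 n * map_mat to_fract p) $$ (0, 0) = to_fract ((ones_mat 1 n * p) $$ (0, 0))"
    using p by (simp add: scalar_prod_def F.hom_sum)
  ultimately show thesis
    using that[OF p eq deg] by simp
qed

abbreviation entry_sum :: "'a :: comm_ring_1 mat \<Rightarrow> 'a" where
  "entry_sum M \<equiv> (ones_mat 1 (dim_row M) * (M * ones_mat (dim_col M) 1)) $$ (0, 0)"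

lemma const_mat_ones_mat: "const_mat (ones_mat r c) = ones_mat r c"
  by (intro eq_matI) (simp_all add: pCons_one)

lemma const_mat_mult:
  assumes "A \<in> carrier_mat r n" "B \<in> carrier_mat n c"
  shows "const_mat (A * B) = const_mat A * const_mat B"
proof -
  interpret comm_ring_hom "\<lambda>a :: complex. [:a:]"
    by unfold_locales (simp_all add: pCons_one)
  show ?thesis using assms by (rule mat_hom_mult)
qed

text \<open>This is the beginning of the expansion of the coronal at infinity,
\<open>\<chi>(x) = 1\<^sup>T 1 / x + 1\<^sup>T A 1 / x\<^sup>2 + 1\<^sup>T A\<^sup>2 1 / x\<^sup>3 + \<dots>\<close>, multiplied by \<open>x\<^sup>2\<close> and by the
characteristic polynomial. With the numerator \<open>p\<close> of the previous lemma, the polynomial whose degree is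
bounded is \<open>1\<^sup>T A\<^sup>2 p\<close>.\<close>

lemma coronal_expansion:
  assumes A: "A \<in> carrier_mat n n" and n: "0 < n"
  obtains s where "to_fract s = to_fract (char_poly A) * coronal A"
    and "degree ([:0, 1:] * ([:0, 1:] * s - of_nat n * char_poly A) - [:entry_sum A:] * char_poly A) < n"
proof -
  let ?X = "[:0, 1:] :: complex poly"
  obtain p where p: "p \<in> carrier_mat n 1"
    and eq: "?X \<cdot>\<^sub>m p - const_mat A * p = char_poly A \<cdot>\<^sub>m ones_mat n 1"
    and deg: "\<And>i. i < n \<Longrightarrow> degree (p $$ (i, 0)) < n"
    and cor: "to_fract ((ones_mat 1 n * p) $$ (0, 0)) = to_fract (char_poly A) * coronal A"
    by (rule coronal_numerator[OF A], rule that)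
  let ?a = "const_mat A" and ?f = "char_poly A"
  let ?o = "ones_mat 1 n :: complex poly mat" and ?e = "ones_mat n 1 :: complex poly mat"
  have a: "?a \<in> carrier_mat n n" using A by simp
  have o: "?o \<in> carrier_mat 1 n" and e: "?e \<in> carrier_mat n 1" by simp_all
  have ap: "?a * p \<in> carrier_mat n 1" and aap: "?a * (?a * p) \<in> carrier_mat n 1"
    using a p by simp_all
  \<comment> \<open>An equation of the form of that for \<open>p\<close>, summed over its rows. It serves for \<open>p\<close> and again for
    \<open>A p\<close>, each use contributing one term of the expansion.\<close>
  have step: "(?o * (?a * v)) $$ (0, 0) = ?X * (?o * v) $$ (0, 0) - ?f * (?o * u) $$ (0, 0)"
    if v: "v \<in> carrier_mat n 1" and u: "u \<in> carrier_mat n 1" and vu: "?X \<cdot>\<^sub>m v - ?a * v = ?f \<cdot>\<^sub>m u"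
    for v u
  proof -
    have "?X \<cdot>\<^sub>m (?o * v) - ?o * (?a * v) = ?f \<cdot>\<^sub>m (?o * u)"
      unfolding mult_smult_distrib[OF o v, symmetric] mult_smult_distrib[OF o u, symmetric] vu[symmetric]
      by (rule mult_minus_distrib_mat[OF o smult_carrier_mat[OF v] mult_carrier_mat[OF a v], symmetric])
    from arg_cong[OF this, of "\<lambda>M. M $$ (0, 0)"] show ?thesis
      using u v by (simp add: algebra_simps del: One_nat_def)
  qed
  have 1: "(?o * (?a * p)) $$ (0, 0) = ?X * (?o * p) $$ (0, 0) - of_nat n * ?f"
    unfolding step[OF p e eq] ones_mat_mult_ones_mat by (simp add: mult.commute)
  have "?X \<cdot>\<^sub>m (?a * p) - ?a * (?a * p) = ?f \<cdot>\<^sub>m (?a * ?e)"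
    unfolding mult_smult_distrib[OF a p, symmetric] mult_smult_distrib[OF a e, symmetric] eq[symmetric]
    by (rule mult_minus_distrib_mat[OF a smult_carrier_mat[OF p] mult_carrier_mat[OF a p], symmetric])
  then have 2: "(?o * (?a * (?a * p))) $$ (0, 0) = ?X * (?o * (?a * p)) $$ (0, 0) - ?f * (?o * (?a * ?e)) $$ (0, 0)"
    by (rule step[OF ap mult_carrier_mat[OF a e]])
  have "?o * (?a * ?e) = const_mat (ones_mat 1 n * (A * ones_mat n 1))"
    by (simp only: const_mat_mult[OF ones_mat_carrier mult_carrier_mat[OF A ones_mat_carrier]]
        const_mat_mult[OF A ones_mat_carrier] const_mat_ones_mat)
  then have 3: "(?o * (?a * ?e)) $$ (0, 0) = [:entry_sum A:]"
    using A by simp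
  have deg_a: "degree ((?a * p) $$ (i, 0)) < n" if "i < n" for i
    using degree_const_mat_mult_less[OF p A n deg that] .
  have deg_aa: "degree ((?a * (?a * p)) $$ (i, 0)) < n" if "i < n" for i
    using degree_const_mat_mult_less[OF ap A n deg_a that] .
  have "degree ((?o * (?a * (?a * p))) $$ (0, 0)) < n"
    by (rule degree_const_mat_mult_less[OF aap, of "ones_mat 1 n" 1 n 0, unfolded const_mat_ones_mat])
      (rule ones_mat_carrier n deg_aa | assumption | simp)+
  then show thesis
    using that[OF cor] unfolding 2 1 3 by (simp only: mult.commute[of ?f])
qed

text \<open>Subtracting the two expansions leaves a multiple of the characteristic polynomial of degree below
\<open>n\<close>; that polynomial has degree \<open>n\<close>, so the factor, which is the difference of the two entry sums,
vanishes.\<close>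

lemma entry_sum_determined:
  assumes A: "A \<in> carrier_mat n n" and A': "A' \<in> carrier_mat n n" and n: "0 < n"
    and f: "char_poly A = char_poly A'" and c: "coronal A = coronal A'"
  shows "entry_sum A = entry_sum A'"
proof -
  let ?u = "\<lambda>A s. [:0, 1:] * ([:0, 1:] * s - of_nat n * char_poly A) - [:entry_sum A:] * char_poly A"
  obtain s where s: "to_fract s = to_fract (char_poly A) * coronal A" and deg: "degree (?u A s) < n"
    by (rule coronal_expansion[OF A n], rule that)
  obtain s' where s': "to_fract s' = to_fract (char_poly A') * coronal A'" and deg': "degree (?u A' s') < n"
    by (rule coronal_expansion[OF A' n], rule that)
  have "to_fract s' = to_fract s" unfolding s s' f c ..
  then have ss: "s' = s" by simp
  let ?d = "entry_sum A - entry_sum A'"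
  have distrib: "[:x - y:] * q = [:x:] * q - [:y:] * q" for x y :: complex and q
    by (simp add: smult_diff_left)
  have "degree (?u A' s' - ?u A s) < n" using deg' deg by (rule degree_diff_less)
  also have "?u A' s' - ?u A s = [:?d:] * char_poly A"
    unfolding ss f distrib by (simp only: algebra_simps)
  finally have "?d = 0"
    using degree_monic_char_poly[OF A] by (cases "?d = 0") auto
  then show ?thesis by simp
qed

text \<open>Through the incidence matrices: the all-ones vector of the vertices becomes the all-ones vector of the
arcs from either side.\<close>

lemma entry_sum_adjacency_mat:
  assumes "simple_digraph D" "vertex_enum D vs"
  shows "entry_sum (adjacency_mat D vs) = of_nat (card (parcs D))"
proof -
  obtain es where es: "distinct es" "set es = parcs D" and m: "length es = card (parcs D)"
    and inc: "fst ` set es \<subseteq> set vs" "snd ` set es \<subseteq> set vs"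
    by (rule simple_digraph_arc_list[OF assms], rule that)
  have d: "distinct vs" using assms by (simp add: vertex_enum_def)
  let ?n = "length vs" and ?T = "tail_mat vs es :: complex mat" and ?H = "head_mat vs es :: complex mat"
  have A: "adjacency_mat D vs = ?T * ?H"
    unfolding map_adjacency_mat[OF es, of "\<lambda>a. a" vs, simplified, symmetric] by (intro eq_matI) auto
  have "ones_mat 1 ?n * (?T * ?H * ones_mat ?n 1) = ones_mat 1 ?n * (?T * (?H * ones_mat ?n 1))"
    by (simp only: assoc_mult_mat[OF incidence_mat_carrier ones_mat_carrier])
  also have "\<dots> = (ones_mat 1 ?n * ?T) * (?H * ones_mat ?n 1)"
    by (rule assoc_mult_mat[symmetric, OF ones_mat_carrier incidence_mat_carrier(1)
          mult_carrier_mat[OF incidence_mat_carrier(2) ones_mat_carrier]])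
  also have "\<dots> = mat 1 1 (\<lambda>_. of_nat (card (parcs D)))"
    by (simp only: ones_mat_mult_tail_mat[OF d inc(1)] head_mat_mult_ones_mat[OF d inc(2)]
      ones_mat_mult_ones_mat m)
  finally show ?thesis
    using adjacency_mat_carrier[of D vs] unfolding A[symmetric] by simp
qed

section \<open>Spectra\<close>

text \<open>Complex polynomials split, so a monic one is the product over its roots.\<close>

lemma monic_complex_poly_eqI:
  fixes p q :: "complex poly"
  assumes "lead_coeff p = 1" "lead_coeff q = 1" "proots p = proots q"
  shows "p = q"
proof -
  have "p = Polynomial.smult (lead_coeff p) (\<Prod>x\<in>#proots p. [:- x, 1:])"
    by (rule complex_poly_decompose_multiset[symmetric])
  also have "\<dots> = Polynomial.smult (lead_coeff q) (\<Prod>x\<in>#proots q. [:- x, 1:])"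
    by (simp only: assms)
  also have "\<dots> = q"
    by (rule complex_poly_decompose_multiset)
  finally show ?thesis .
qed

lemma A_spectrum_eq_iff:
  "A_spectrum D vs = A_spectrum D' vs' \<longleftrightarrow> char_poly (adjacency_mat D vs) = char_poly (adjacency_mat D' vs')"
  using degree_monic_char_poly[OF adjacency_mat_carrier[of D vs]]
    degree_monic_char_poly[OF adjacency_mat_carrier[of D' vs']]
  by (auto simp: A_spectrum_def intro: monic_complex_poly_eqI)

text \<open>The formula for the join involves the order and the size of the first digraph in addition to its
characteristic polynomial and its coronal. The order is the degree of the characteristic polynomial;
the size is the entry sum of the adjacency matrix.\<close>

lemma order_size_determined:
  assumes s: "simple_digraph D" "vertex_enum D vs" and s': "simple_digraph D'" "vertex_enum D' vs'"
    and spec: "A_spectrum D' vs' = A_spectrum D vs"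
    and cor: "coronal (adjacency_mat D' vs') = coronal (adjacency_mat D vs)"
  shows "card (pverts D') = card (pverts D)" and "card (parcs D') = card (parcs D)"
proof -
  have f: "char_poly (adjacency_mat D' vs') = char_poly (adjacency_mat D vs)"
    using spec by (simp add: A_spectrum_eq_iff)
  then have len: "length vs' = length vs"
    using degree_monic_char_poly[OF adjacency_mat_carrier[of D vs]]
      degree_monic_char_poly[OF adjacency_mat_carrier[of D' vs']] by simp
  then show "card (pverts D') = card (pverts D)"
    using s s' by (simp add: vertex_enum_length)
  have "vs \<noteq> []" using s by (auto simp: simple_digraph_def vertex_enum_def)
  then have "(of_nat (card (parcs D')) :: complex) = of_nat (card (parcs D))"
    using entry_sum_determined[OF adjacency_mat_carrier adjacency_mat_carrier[of D' vs', unfolded len] _ f[symmetric] cor[symmetric]]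
      entry_sum_adjacency_mat[OF s] entry_sum_adjacency_mat[OF s'] len by simp
  then show "card (parcs D') = card (parcs D)" by simp
qed

theorem theorem4p7:
  fixes D1 :: "'a pair_pre_digraph" and D2 :: "'b pair_pre_digraph"
    and vs1 :: "'a list" and vs2 :: "'b list" and vs :: "(('a + 'a \<times> 'a) + 'b) list"
    and n1 n2 m1 m2 :: nat
  assumes "simple_digraph D1" and "simple_digraph D2"
    and "vertex_enum D1 vs1" and "vertex_enum D2 vs2"
    and "vertex_enum (subdiv_arc_join D1 D2) vs"
    and "n1 = card (pverts D1)" and "n2 = card (pverts D2)"
    and "m1 = card (parcs D1)" and "m2 = card (parcs D2)"
  shows
    "to_fract (char_poly (adjacency_mat (subdiv_arc_join D1 D2) vs)) =
        ratfun_X powi (int m1 - int n1)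
        * to_fract (char_poly (adjacency_mat D1 vs1) \<circ>\<^sub>p [:0, 0, 1:])
        * to_fract (char_poly (adjacency_mat D2 vs2))
        * (1 - ratfun_X
             * (ratfun_X ^ 2 * ratfun_square (coronal (adjacency_mat D1 vs1)) - of_nat n1)
             * coronal (adjacency_mat D2 vs2))
     \<and> (\<forall>(D1' :: 'c pair_pre_digraph) (D2' :: 'd pair_pre_digraph) vs1' vs2' vs'.
          simple_digraph D1' \<and> simple_digraph D2'
          \<and> vertex_enum D1' vs1' \<and> vertex_enum D2' vs2'
          \<and> vertex_enum (subdiv_arc_join D1' D2') vs'
          \<and> A_spectrum D1' vs1' = A_spectrum D1 vs1
          \<and> A_spectrum D2' vs2' = A_spectrum D2 vs2
          \<and> coronal (adjacency_mat D1' vs1') = coronal (adjacency_mat D1 vs1)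
          \<and> coronal (adjacency_mat D2' vs2') = coronal (adjacency_mat D2 vs2)
          \<longrightarrow> A_spectrum (subdiv_arc_join D1' D2') vs' = A_spectrum (subdiv_arc_join D1 D2) vs)"
    (is "?formula \<and> ?determined")
proof
  \<comment> \<open>The right hand side of this formula depends only on the data assumed equal and on the order and
    size of the first digraph.\<close>
  note F = char_poly_subdiv_arc_join[OF assms(1,3-5)]
  show ?formula using F assms(6,8) by simp
  show ?determined
  proof (intro allI impI, elim conjE)
    fix D1' :: "'c pair_pre_digraph" and D2' :: "'d pair_pre_digraph" and vs1' vs2' vs'
    assume s: "simple_digraph D1'" "simple_digraph D2'"
      and e: "vertex_enum D1' vs1'" "vertex_enum D2' vs2'" "vertex_enum (subdiv_arc_join D1' D2') vs'"
      and spec: "A_spectrum D1' vs1' = A_spectrum D1 vs1" "A_spectrum D2' vs2' = A_spectrum D2 vs2"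
      and cor: "coronal (adjacency_mat D1' vs1') = coronal (adjacency_mat D1 vs1)"
        "coronal (adjacency_mat D2' vs2') = coronal (adjacency_mat D2 vs2)"
    have "char_poly (adjacency_mat D1' vs1') = char_poly (adjacency_mat D1 vs1)"
      "char_poly (adjacency_mat D2' vs2') = char_poly (adjacency_mat D2 vs2)"
      using spec by (simp_all add: A_spectrum_eq_iff)
    then have "to_fract (char_poly (adjacency_mat (subdiv_arc_join D1' D2') vs'))
        = to_fract (char_poly (adjacency_mat (subdiv_arc_join D1 D2) vs))"
      using order_size_determined[OF assms(1,3) s(1) e(1) spec(1) cor(1)]
      by (simp only: F char_poly_subdiv_arc_join[OF s(1) e] cor)
    then show "A_spectrum (subdiv_arc_join D1' D2') vs' = A_spectrum (subdiv_arc_join D1 D2) vs"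
      by (simp add: A_spectrum_def)
  qed
qed

end
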